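(* Let $E$ be a finite commutative semifield of order $q$, and let $H=\{H_{u,b}:u,b\in E\}$ be the associated abelian group of order $q^2$, with subset $H_0=\{H_{u,0}:u\in E\}$. Then the characters of $H$ restricted to $H_0$, together with the standard basis, are a set of $q+1$ mutually unbiased bases in $\mathbb{C}^q$. That is, identifying $\mathbb{C}^{H_0}$ with $\mathbb{C}^q$, the $q^2$ vectors $\frac1{\sqrt q}\,\chi|_{H_0}$, with $\chi$ ranging over the characters of $H$, can be partitioned into $q$ orthonormal bases which together with the standard basis form $q+1$ pairwise mutually unbiased bases.
   Context: A finite semifield is a finite set $E$ with operations $+$ and $\circ$ such that: $(E,+)$ is an abelian group with identity $0$; $x\circ y=0$ implies $x=0$ or $y=0$; $x\circ(y+z)=x\circ y+x\circ z$ and $(y+z)\circ x=y\circ x+z\circ x$; and there is a multiplicative identity $1\neq 0$. (Multiplication need not be associative.) It is commutative if $\circ$ is commutative. For $u,b\in E$ the map $H_{u,b}:E\times E\to E\times E$ is $H_{u,b}=T_{u,b}S_{u,0}$ (apply $S_{u,0}$ first), where $T_{a,b}(x,y)=(x+a,y+b)$ and $S_{u,v}(x,y)=(x,y+u\circ x+v)$. Under composition $H_{u,b}H_{v,d}=H_{u+v,\,b+d+u\circ v}$, so $H$ is a group, which is abelian since $E$ is commutative. Characters are homomorphisms $H\to\mathbb{C}^*$. Two bases $x_1,\dots,x_d$ and $y_1,\dots,y_d$ of $\mathbb{C}^d$ are mutually unbiased if both are orthonormal and there is a constant $a$ such that $|\langle x_i,y_j\rangle|=a$ for all $i,j$. 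*)

theory Defs
  imports
    "HOL-Algebra.Bij"
    "HOL-Library.Disjoint_Sets"
    "Jordan_Normal_Form.VS_Connect"
    "Jordan_Normal_Form.Conjugate"
begin

section \<open>Finite semifields\<close>

text \<open>The ring record serves only as a signature here: multiplication is not assumed to be
  associative, and the semifield product is written \<open>\<otimes>\<close>.\<close>

locale finite_semifield = abelian_group E for E (structure) +
  assumes finite_carrier: "finite (carrier E)"
    and mult_closed: "\<lbrakk> x \<in> carrier E; y \<in> carrier E \<rbrakk> \<Longrightarrow> x \<otimes> y \<in> carrier E"
    and no_zero_divisors:
      "\<lbrakk> x \<in> carrier E; y \<in> carrier E; x \<otimes> y = \<zero> \<rbrakk> \<Longrightarrow> x = \<zero> \<or> y = \<zero>"
    and distrib_left: "\<lbrakk> x \<in> carrier E; y \<in> carrier E; z \<in> carrier E \<rbrakk>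
      \<Longrightarrow> x \<otimes> (y \<oplus> z) = x \<otimes> y \<oplus> x \<otimes> z"
    and distrib_right: "\<lbrakk> x \<in> carrier E; y \<in> carrier E; z \<in> carrier E \<rbrakk>
      \<Longrightarrow> (y \<oplus> z) \<otimes> x = y \<otimes> x \<oplus> z \<otimes> x"
    and one_carrier: "\<one> \<in> carrier E"
    and one_neq_zero: "\<one> \<noteq> \<zero>"
    and one_mult: "x \<in> carrier E \<Longrightarrow> \<one> \<otimes> x = x"
    and mult_one: "x \<in> carrier E \<Longrightarrow> x \<otimes> \<one> = x"

locale finite_commutative_semifield = finite_semifield E for E (structure) +
  assumes mult_commute: "\<lbrakk> x \<in> carrier E; y \<in> carrier E \<rbrakk> \<Longrightarrow> x \<otimes> y = y \<otimes> x"

section \<open>The group \<open>H\<close> and its characters\<close>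

text \<open>As usual in HOL-Algebra, maps on \<open>E \<times> E\<close> are extensional, so that equality of functions is
  equality on \<open>E \<times> E\<close>.\<close>

definition T_map :: "('a, 'm) ring_scheme \<Rightarrow> 'a \<Rightarrow> 'a \<Rightarrow> 'a \<times> 'a \<Rightarrow> 'a \<times> 'a" where
  "T_map E a b = (\<lambda>(x, y) \<in> carrier E \<times> carrier E. (x \<oplus>\<^bsub>E\<^esub> a, y \<oplus>\<^bsub>E\<^esub> b))"

definition S_map :: "('a, 'm) ring_scheme \<Rightarrow> 'a \<Rightarrow> 'a \<Rightarrow> 'a \<times> 'a \<Rightarrow> 'a \<times> 'a" where
  "S_map E u v =
    (\<lambda>(x, y) \<in> carrier E \<times> carrier E. (x, y \<oplus>\<^bsub>E\<^esub> u \<otimes>\<^bsub>E\<^esub> x \<oplus>\<^bsub>E\<^esub> v))"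

definition H_map :: "('a, 'm) ring_scheme \<Rightarrow> 'a \<Rightarrow> 'a \<Rightarrow> 'a \<times> 'a \<Rightarrow> 'a \<times> 'a" where
  "H_map E u b = compose (carrier E \<times> carrier E) (T_map E u b) (S_map E u \<zero>\<^bsub>E\<^esub>)"

definition H_group :: "('a, 'm) ring_scheme \<Rightarrow> ('a \<times> 'a \<Rightarrow> 'a \<times> 'a) monoid" where
  "H_group E = BijGroup (carrier E \<times> carrier E)
     \<lparr> carrier := {H_map E u b | u b. u \<in> carrier E \<and> b \<in> carrier E} \<rparr>"

definition H_zero :: "('a, 'm) ring_scheme \<Rightarrow> ('a \<times> 'a \<Rightarrow> 'a \<times> 'a) set" where
  "H_zero E = {H_map E u \<zero>\<^bsub>E\<^esub> | u. u \<in> carrier E}"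

text \<open>Homomorphisms into \<open>\<complex>\<^sup>*\<close>; extensionality ensures that each character is counted only once.\<close>

definition characters :: "('g, 'm) monoid_scheme \<Rightarrow> ('g \<Rightarrow> complex) set" where
  "characters G = hom G (units_of class_ring) \<inter> extensional (carrier G)"

section \<open>Mutually unbiased bases of \<open>\<complex>\<^sup>d\<close>\<close>

text \<open>Bases are unordered, i.e. sets of vectors; an orthonormal family has no repetitions.\<close>

definition orthonormal_basis :: "nat \<Rightarrow> complex vec set \<Rightarrow> bool" where
  "orthonormal_basis d B \<longleftrightarrow>
     vectorspace.basis class_ring (module_vec TYPE(complex) d) B \<and>
     (\<forall>x\<in>B. \<forall>y\<in>B. x \<bullet>c y = (if x = y then 1 else 0))"

definition mutually_unbiased :: "nat \<Rightarrow> complex vec set \<Rightarrow> complex vec set \<Rightarrow> bool" where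
  "mutually_unbiased d B C \<longleftrightarrow>
     orthonormal_basis d B \<and> orthonormal_basis d C \<and>
     (\<exists>a::real. \<forall>x\<in>B. \<forall>y\<in>C. cmod (x \<bullet>c y) = a)"

text \<open>The vector \<open>\<chi>|\<^bsub>H\<^sub>0\<^esub> / \<surd>q\<close>, read as an element of \<open>\<complex>\<^sup>q\<close> along an enumeration \<open>h\<close>
  of the \<open>q\<close> elements of \<open>H\<^sub>0\<close>.\<close>

definition char_vec :: "nat \<Rightarrow> (nat \<Rightarrow> 'g) \<Rightarrow> ('g \<Rightarrow> complex) \<Rightarrow> complex vec" where
  "char_vec q h \<chi> = vec q (\<lambda>i. \<chi> (h i) / complex_of_real (sqrt (real q)))"

section \<open>\<open>H\<close> is an abelian group of order \<open>q\<^sup>2\<close>\<close>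

context finite_semifield
begin

lemma H_map_apply:
  assumes "u \<in> carrier E" "b \<in> carrier E" "x \<in> carrier E" "y \<in> carrier E"
  shows "H_map E u b (x, y) = (x \<oplus> u, y \<oplus> u \<otimes> x \<oplus> b)"
  using assms by (simp add: H_map_def T_map_def S_map_def compose_def mult_closed)

lemma H_map_Bij:
  assumes u: "u \<in> carrier E" and b: "b \<in> carrier E"
  shows "H_map E u b \<in> Bij (carrier E \<times> carrier E)"
proof -
  let ?P = "carrier E \<times> carrier E"
  have "inj_on (H_map E u b) ?P"
    using u b by (auto simp: inj_on_def H_map_apply mult_closed)
  moreover have "H_map E u b ` ?P \<subseteq> ?P"
    using u b by (auto simp: H_map_apply mult_closed)
  ultimately have "bij_betw (H_map E u b) ?P ?P"
    using finite_carrier by (simp add: bij_betw_def endo_inj_surj)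
  then show ?thesis
    by (simp add: Bij_def H_map_def compose_extensional)
qed

lemma H_map_mult:
  assumes "u \<in> carrier E" "b \<in> carrier E" "v \<in> carrier E" "d \<in> carrier E"
  shows "H_map E u b \<otimes>\<^bsub>H_group E\<^esub> H_map E v d = H_map E (u \<oplus> v) (b \<oplus> d \<oplus> u \<otimes> v)"
proof -
  let ?P = "carrier E \<times> carrier E"
  have "compose ?P (H_map E u b) (H_map E v d) = H_map E (u \<oplus> v) (b \<oplus> d \<oplus> u \<otimes> v)"
  proof (rule extensionalityI[of _ ?P])
    show "H_map E (u \<oplus> v) (b \<oplus> d \<oplus> u \<otimes> v) \<in> extensional ?P"
      by (simp add: H_map_def compose_extensional)
    fix p assume "p \<in> ?P"
    then show "compose ?P (H_map E u b) (H_map E v d) p = H_map E (u \<oplus> v) (b \<oplus> d \<oplus> u \<otimes> v) p"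
      using assms
      by (auto simp: compose_def H_map_apply mult_closed distrib_left distrib_right a_ac)
  qed (simp add: compose_extensional)
  then show ?thesis
    using assms by (simp add: H_group_def BijGroup_def H_map_Bij)
qed

lemma inj_H_map: "inj_on (\<lambda>(u, b). H_map E u b) (carrier E \<times> carrier E)"
proof (rule inj_onI, clarify)
  fix u b v d
  assume *: "u \<in> carrier E" "b \<in> carrier E" "v \<in> carrier E" "d \<in> carrier E"
    and eq: "H_map E u b = H_map E v d"
  then have "H_map E u b (\<zero>, \<zero>) = H_map E v d (\<zero>, \<zero>)"
    by simp
  then have "u = v \<and> u \<otimes> \<zero> \<oplus> b = v \<otimes> \<zero> \<oplus> d"
    using * by (auto simp: H_map_apply mult_closed)
  then show "u = v \<and> b = d"
    using * by (auto simp: mult_closed)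
qed

lemma order_H_group: "Coset.order (H_group E) = (Coset.order E)\<^sup>2"
proof -
  have "carrier (H_group E) = (\<lambda>(u, b). H_map E u b) ` (carrier E \<times> carrier E)"
    by (auto simp: H_group_def)
  then show ?thesis
    by (simp add: Coset.order_def card_image[OF inj_H_map] card_cartesian_product power2_eq_square)
qed

lemma card_H_zero: "card (H_zero E) = Coset.order E"
proof -
  have "H_zero E = (\<lambda>u. H_map E u \<zero>) ` carrier E"
    by (auto simp: H_zero_def)
  moreover have "inj_on (\<lambda>u. H_map E u \<zero>) (carrier E)"
    using inj_onD[OF inj_H_map] by (intro inj_onI) force
  ultimately show ?thesis
    by (simp add: Coset.order_def card_image)
qed

end

lemma (in finite_commutative_semifield) comm_group_H_group: "comm_group (H_group E)"
proof -
  let ?P = "carrier E \<times> carrier E"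
  have zl: "\<zero> \<otimes> x = \<zero>" if "x \<in> carrier E" for x
    using that distrib_right[of x \<zero> \<zero>] by (simp add: mult_closed)
  have one: "\<one>\<^bsub>H_group E\<^esub> = H_map E \<zero> \<zero>"
  proof (rule extensionalityI[of _ ?P])
    show "\<one>\<^bsub>H_group E\<^esub> \<in> extensional ?P" "H_map E \<zero> \<zero> \<in> extensional ?P"
      by (simp_all add: H_group_def BijGroup_def H_map_def compose_extensional)
    fix p assume "p \<in> ?P"
    then show "\<one>\<^bsub>H_group E\<^esub> p = H_map E \<zero> \<zero> p"
      by (auto simp: H_group_def BijGroup_def H_map_apply zl)
  qed
  have car: "carrier (H_group E) = {H_map E u b | u b. u \<in> carrier E \<and> b \<in> carrier E}"
    by (simp add: H_group_def)
  show ?thesis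
  proof (rule comm_groupI)
    fix x y z assume "x \<in> carrier (H_group E)" "y \<in> carrier (H_group E)" "z \<in> carrier (H_group E)"
    then show "x \<otimes>\<^bsub>H_group E\<^esub> y \<otimes>\<^bsub>H_group E\<^esub> z = x \<otimes>\<^bsub>H_group E\<^esub> (y \<otimes>\<^bsub>H_group E\<^esub> z)"
      unfolding car
      by (auto simp: H_map_mult mult_closed distrib_left distrib_right a_ac)
  next
    fix x y assume "x \<in> carrier (H_group E)" "y \<in> carrier (H_group E)"
    then show "x \<otimes>\<^bsub>H_group E\<^esub> y \<in> carrier (H_group E)"
      unfolding car by (force simp: H_map_mult mult_closed)
  next
    fix x y assume "x \<in> carrier (H_group E)" "y \<in> carrier (H_group E)"
    then show "x \<otimes>\<^bsub>H_group E\<^esub> y = y \<otimes>\<^bsub>H_group E\<^esub> x"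
      unfolding car by (auto simp: H_map_mult mult_closed mult_commute a_ac)
  next
    show "\<one>\<^bsub>H_group E\<^esub> \<in> carrier (H_group E)"
      unfolding car one by auto
  next
    fix x assume "x \<in> carrier (H_group E)"
    then show "\<one>\<^bsub>H_group E\<^esub> \<otimes>\<^bsub>H_group E\<^esub> x = x"
      unfolding car one by (auto simp: H_map_mult zl)
  next
    fix x assume "x \<in> carrier (H_group E)"
    then obtain u b where x: "x = H_map E u b" and u: "u \<in> carrier E" and b: "b \<in> carrier E"
      unfolding car by auto
    let ?c = "\<ominus> (b \<oplus> (\<ominus> u) \<otimes> u)"
    have "H_map E (\<ominus> u) ?c \<otimes>\<^bsub>H_group E\<^esub> x = H_map E (\<ominus> u \<oplus> u) (?c \<oplus> b \<oplus> (\<ominus> u) \<otimes> u)"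
      using u b by (simp add: x H_map_mult mult_closed)
    also have "?c \<oplus> b \<oplus> (\<ominus> u) \<otimes> u = \<zero>"
      using u b by (simp add: mult_closed a_assoc l_neg)
    finally have "H_map E (\<ominus> u) ?c \<otimes>\<^bsub>H_group E\<^esub> x = \<one>\<^bsub>H_group E\<^esub>"
      using u by (simp add: one l_neg)
    moreover have "H_map E (\<ominus> u) ?c \<in> carrier (H_group E)"
    proof -
      have "\<ominus> u \<in> carrier E" "?c \<in> carrier E"
        using u b by (simp_all add: mult_closed)
      then show ?thesis
        unfolding car by blast
    qed
    ultimately show "\<exists>y\<in>carrier (H_group E). y \<otimes>\<^bsub>H_group E\<^esub> x = \<one>\<^bsub>H_group E\<^esub>"
      by blast
  qed
qed

end

theory Submission
  imports Defs "HOL-Algebra.Multiplicative_Group"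
begin

text \<open>The map \<open>b \<mapsto> H\<^bsub>0,b\<^esub>\<close> embeds \<open>(E, +)\<close> in \<open>H\<close>; the bases are formed by the
  characters with the same restriction to this central copy of \<open>E\<close>. For \<open>\<theta> = \<chi> \<cdot> cnj \<psi>\<close> the relation
  \<open>H\<^bsub>u,0\<^esub> H\<^bsub>v,0\<^esub> = H\<^bsub>u+v,0\<^esub> H\<^bsub>0,uv\<^esub>\<close> shows that \<open>u \<mapsto> \<theta> H\<^bsub>u,0\<^esub>\<close> is a character of \<open>(E, +)\<close>
  if the restrictions agree, so its sum vanishes. If they differ, the sum over \<open>H\<^sub>0\<close> has modulus
  \<open>\<surd>q\<close>: squaring it leaves inner sums of a nontrivial character of \<open>(E, +)\<close> over
  \<open>{vw | v. v \<in> E}\<close>, which vanish unless \<open>w = 0\<close>. As orthonormal sets have at most \<open>q\<close> elements and there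
  are \<open>q\<^sup>2\<close> characters of \<open>H\<close> and \<open>q\<close> of \<open>(E, +)\<close>, each class has exactly \<open>q\<close> elements.\<close>

section \<open>Characters of finite abelian groups\<close>

lemma characters_iff:
  "\<chi> \<in> characters G \<longleftrightarrow>
    \<chi> \<in> extensional (carrier G) \<and> (\<forall>x\<in>carrier G. \<chi> x \<noteq> 0) \<and>
    (\<forall>x\<in>carrier G. \<forall>y\<in>carrier G. \<chi> (x \<otimes>\<^bsub>G\<^esub> y) = \<chi> x * \<chi> y)"
proof -
  have "carrier (units_of class_ring) = {z :: complex. z \<noteq> 0}"
    by (auto simp: units_of_def Units_def) (metis left_inverse right_inverse)
  moreover have "mult (units_of class_ring) = ((*) :: complex \<Rightarrow> _)"
    by (simp add: units_of_def)
  ultimately show ?thesis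
    by (auto simp: characters_def hom_def)
qed

lemma character_ne_0: "\<lbrakk>\<chi> \<in> characters G; x \<in> carrier G\<rbrakk> \<Longrightarrow> \<chi> x \<noteq> 0"
  and character_mult:
    "\<lbrakk>\<chi> \<in> characters G; x \<in> carrier G; y \<in> carrier G\<rbrakk> \<Longrightarrow> \<chi> (x \<otimes>\<^bsub>G\<^esub> y) = \<chi> x * \<chi> y"
  and character_extensional: "\<chi> \<in> characters G \<Longrightarrow> \<chi> \<in> extensional (carrier G)"
  by (auto simp: characters_iff)

lemma character_eqI:
  assumes "\<chi> \<in> characters G" "\<psi> \<in> characters G" "\<And>x. x \<in> carrier G \<Longrightarrow> \<chi> x = \<psi> x"
  shows "\<chi> = \<psi>"
  using assms by (blast intro: extensionalityI character_extensional)

section \<open>Values and orthogonality of characters\<close>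

context group
begin

lemma character_one: assumes "\<chi> \<in> characters G" shows "\<chi> \<one> = 1"
  using character_mult[OF assms one_closed one_closed] character_ne_0[OF assms one_closed] by simp

lemma character_pow:
  assumes "\<chi> \<in> characters G" "x \<in> carrier G" shows "\<chi> (x [^] (n::nat)) = \<chi> x ^ n"
  using assms by (induction n) (auto simp: character_one character_mult)

lemma character_root_of_unity:
  assumes "\<chi> \<in> characters G" "x \<in> carrier G" shows "\<chi> x ^ Coset.order G = 1"
  using assms by (metis character_one character_pow pow_order_eq_1)

lemma cmod_character:
  assumes "finite (carrier G)" "\<chi> \<in> characters G" "x \<in> carrier G" shows "cmod (\<chi> x) = 1"
  using power_eq_1_iff[OF character_root_of_unity[OF assms(2,3)]] assms(1)
  by (simp add: order_gt_0_iff_finite[symmetric])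

text \<open>All values are roots of unity of one fixed order, and extensionality leaves no freedom
  off the carrier, so the characters lie in a finite product of finite sets.\<close>

lemma finite_characters:
  assumes "finite (carrier G)" shows "finite (characters G)"
proof (rule finite_subset)
  show "characters G \<subseteq> (\<Pi>\<^sub>E x\<in>carrier G. {z. z ^ Coset.order G = 1})"
    by (auto simp: PiE_def character_root_of_unity character_extensional)
  show "finite (\<Pi>\<^sub>E x\<in>carrier G. {z::complex. z ^ Coset.order G = 1})"
    using assms by (intro finite_PiE finite_nth_roots) (auto simp: order_gt_0_iff_finite)
qed

text \<open>Conjugation is multiplicative and vanishes only at 0. This turns an inner product of two
  characters into a sum of a single one.\<close>

lemma character_mult_cnj:
  assumes "\<chi> \<in> characters G" "\<psi> \<in> characters G"
  shows "(\<lambda>x\<in>carrier G. \<chi> x * cnj (\<psi> x)) \<in> characters G"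
  using assms by (simp add: characters_iff)

text \<open>Translation by \<open>y\<close> permutes the group and scales the sum by
  \<open>\<chi> y\<close>, which is not 1.\<close>

lemma sum_character_eq_0:
  assumes \<chi>: "\<chi> \<in> characters G" and y: "y \<in> carrier G" "\<chi> y \<noteq> 1"
  shows "(\<Sum>x\<in>carrier G. \<chi> x) = 0"
proof -
  have "(\<Sum>x\<in>carrier G. \<chi> x) = (\<Sum>x\<in>carrier G. \<chi> (y \<otimes> x))"
    using y(1)
    by (intro sum.reindex_bij_witness[of _ "\<lambda>x. y \<otimes> x" "\<lambda>x. inv y \<otimes> x"])
       (auto simp: m_assoc[symmetric])
  also have "\<dots> = \<chi> y * (\<Sum>x\<in>carrier G. \<chi> x)"
    using \<chi> y(1) by (simp add: character_mult sum_distrib_left)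
  finally show ?thesis
    using y(2) by simp
qed

lemma sum_character_mult_cnj:
  assumes "finite (carrier G)" "\<chi> \<in> characters G" "\<psi> \<in> characters G" "\<chi> \<noteq> \<psi>"
  shows "(\<Sum>x\<in>carrier G. \<chi> x * cnj (\<psi> x)) = 0"
proof -
  obtain y where y: "y \<in> carrier G" "\<chi> y \<noteq> \<psi> y"
    using assms character_eqI by blast
  have "\<psi> y * cnj (\<psi> y) = 1"
    using cmod_character[OF assms(1,3) y(1)] by (simp add: complex_norm_square[symmetric])
  then have "\<chi> y * cnj (\<psi> y) \<noteq> 1"
    using y(2) by (metis mult_right_cancel mult_zero_right zero_neq_one)
  with sum_character_eq_0[OF character_mult_cnj[OF assms(2,3)] y(1)] y(1) show ?thesis
    by simp
qed

end

section \<open>Lower bound for the number of characters\<close>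

context comm_group
begin

text \<open>If \<open>n\<close> is least with \<open>x\<^sup>n \<in> K\<close>, a character \<open>\<psi>\<close> of \<open>K\<close> extends to \<open>\<langle>K, x\<rangle>\<close> in \<open>n\<close> ways, one for each
  \<open>n\<close>-th root of \<open>\<psi> (x\<^sup>n)\<close> as the value at \<open>x\<close>.\<close>

lemma card_characters_adjoin:
  assumes fin: "finite (carrier G)" and K: "subgroup K G" and x: "x \<in> carrier G"
    and le: "card K \<le> card (characters (G\<lparr>carrier := K\<rparr>))"
  obtains L where "subgroup L G" "K \<subseteq> L" "x \<in> L"
    "card L \<le> card (characters (G\<lparr>carrier := L\<rparr>))"
proof -
  interpret K: subgroup K G by fact
  \<comment> \<open>Exponents in \<open>nat\<close> suffice: in a finite group inverses are
    themselves powers.\<close>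
  define L where "L = (\<lambda>(k, i). k \<otimes> x [^] (i::nat)) ` (K \<times> UNIV)"
  have KG: "k \<in> carrier G" if "k \<in> K" for k
    using that K.subset by blast
  have L_iff: "g \<in> L \<longleftrightarrow> (\<exists>k\<in>K. \<exists>i. g = k \<otimes> x [^] (i::nat))" for g
    by (auto simp: L_def)
  have LI: "k \<otimes> x [^] (i::nat) \<in> L" if "k \<in> K" for k i
    using that by (auto simp: L_def)
  have LG: "L \<subseteq> carrier G"
    using x KG by (auto simp: L_def)
  have KL: "K \<subseteq> L"
    using LI[where i = 0] KG by force
  have xL: "x \<in> L"
    using LI[OF K.one_closed, of 1] x by simp
  have mult: "(k \<otimes> x [^] (i::nat)) \<otimes> (k' \<otimes> x [^] (i'::nat)) = (k \<otimes> k') \<otimes> x [^] (i + i')"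
    if "k \<in> K" "k' \<in> K" for k k' i i'
    using that x KG by (simp add: nat_pow_mult[symmetric] m_ac)
  have multL: "g \<otimes> g' \<in> L" if "g \<in> L" "g' \<in> L" for g g'
    using that mult unfolding L_iff by (metis K.m_closed)
  have subL: "subgroup L G"
  proof (rule subgroupI)
    fix g assume g: "g \<in> L"
    then have gG: "g \<in> carrier G"
      using LG by blast
    have pow: "g [^] m \<in> L" for m :: nat
      using K.one_closed KL multL g by (induction m) auto
    have "g [^] (Coset.order G - 1) \<otimes> g = \<one>"
      using fin gG pow_order_eq_1[OF gG]
      by (metis Suc_diff_1 nat_pow_Suc order_gt_0_iff_finite)
    then have "inv g = g [^] (Coset.order G - 1)"
      using gG by (metis inv_equality nat_pow_closed)
    then show "inv g \<in> L"
      using pow by simp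
  qed (use LG xL multL in auto)
  \<comment> \<open>\<open>n\<close> is the order of \<open>x\<close> modulo \<open>K\<close>; it
    exists because \<open>x [^] Coset.order G = \<one>\<close>.\<close>
  define n where "n = (LEAST n::nat. 0 < n \<and> x [^] n \<in> K)"
  have "0 < Coset.order G \<and> x [^] Coset.order G \<in> K"
    using x fin by (simp add: pow_order_eq_1 order_gt_0_iff_finite)
  then have n: "0 < n" "x [^] n \<in> K"
    using LeastI[of "\<lambda>n::nat. 0 < n \<and> x [^] n \<in> K" "Coset.order G"]
    by (auto simp: n_def)
  have powK: "k [^] (m::nat) \<in> K" if "k \<in> K" for k m
    using that by (induction m) auto
  \<comment> \<open>Division with remainder by \<open>n\<close> serves twice: minimality forces the
    remainder of any exponent landing in \<open>K\<close> to be 0, and reduced exponents give the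
    bound on \<open>card L\<close>.\<close>
  have split: "x [^] m = (x [^] n) [^] (m div n) \<otimes> x [^] (m mod n)" for m
    using x by (simp add: nat_pow_pow nat_pow_mult)
  have n_dvd: "n dvd m" if "x [^] m \<in> K" for m
  proof -
    have "x [^] (m mod n) = inv ((x [^] n) [^] (m div n)) \<otimes> x [^] m"
      using x by (subst split) (simp add: inv_solve_left)
    then have "x [^] (m mod n) \<in> K"
      using that n powK by simp
    then have "\<not> 0 < m mod n"
      using not_less_Least[of "m mod n" "\<lambda>n::nat. 0 < n \<and> x [^] n \<in> K"] n(1) by (auto simp: n_def)
    then show ?thesis
      by auto
  qed
  have "card L \<le> card (K \<times> {..<n})"
  proof (rule surj_card_le)
    show "finite (K \<times> {..<n})"
      using fin K.subset finite_subset by blast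
    show "L \<subseteq> (\<lambda>(k, i). k \<otimes> x [^] i) ` (K \<times> {..<n})"
    proof
      fix g assume "g \<in> L"
      then obtain k i where k: "k \<in> K" and g: "g = k \<otimes> x [^] (i::nat)"
        by (auto simp: L_iff)
      have "g = (k \<otimes> (x [^] n) [^] (i div n)) \<otimes> x [^] (i mod n)"
        using g k x KG by (subst (asm) split) (simp add: m_assoc)
      moreover have "k \<otimes> (x [^] n) [^] (i div n) \<in> K"
        using k n powK by simp
      ultimately show "g \<in> (\<lambda>(k, i). k \<otimes> x [^] i) ` (K \<times> {..<n})"
        using n by force
    qed
  qed
  then have cardL: "card L \<le> n * card K"
    by (simp add: card_cartesian_product mult.commute)
  let ?K = "G\<lparr>carrier := K\<rparr>" and ?L = "G\<lparr>carrier := L\<rparr>"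
  interpret GK: group ?K
    using K by (rule subgroup_imp_group)
  interpret GL: group ?L
    using subL by (rule subgroup_imp_group)
  define D where "D = (SIGMA \<psi>:characters ?K. {z. z ^ n = \<psi> (x [^] n)})"
  \<comment> \<open>Cancelling the smaller power of \<open>x\<close> puts
    \<open>x [^] (j - i)\<close> into \<open>K\<close>, so \<open>n\<close> divides
    \<open>j - i\<close>, and \<open>z ^ n = \<psi> (x [^] n)\<close> makes the two candidate values
    agree.\<close>
  have wd': "\<psi> k * z ^ i = \<psi> k' * z ^ j"
    if D: "(\<psi>, z) \<in> D" and k: "k \<in> K" "k' \<in> K"
      and eq: "k \<otimes> x [^] i = k' \<otimes> x [^] j" and ij: "i \<le> j" for \<psi> z k k' and i j :: nat
  proof -
    have \<psi>: "\<psi> \<in> characters ?K" and z: "z ^ n = \<psi> (x [^] n)"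
      using D by (auto simp: D_def)
    have "k \<otimes> x [^] i = (k' \<otimes> x [^] (j - i)) \<otimes> x [^] i"
      using eq ij k x KG by (simp add: m_assoc nat_pow_mult)
    then have k_eq: "k = k' \<otimes> x [^] (j - i)"
      using k x KG by simp
    then have "x [^] (j - i) = inv k' \<otimes> k"
      using k x KG by (simp add: m_assoc[symmetric])
    then have "x [^] (j - i) \<in> K"
      using k by simp
    then obtain m where m: "j - i = n * m"
      using n_dvd by blast
    then have "k = k' \<otimes> (x [^] n) [^] m"
      using k_eq x by (simp add: nat_pow_pow)
    moreover have "\<psi> (k' \<otimes> (x [^] n) [^] m) = \<psi> k' * \<psi> (x [^] n) ^ m"
      using character_mult[OF \<psi>, of k' "(x [^] n) [^] m"] GK.character_pow[OF \<psi>, of "x [^] n" m]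
        k n powK by (simp add: nat_pow_consistent[symmetric])
    ultimately have "\<psi> k = \<psi> k' * z ^ (j - i)"
      using z m by (simp add: power_mult)
    then show ?thesis
      using ij by (simp add: power_add[symmetric])
  qed
  have wd: "\<psi> k * z ^ i = \<psi> k' * z ^ j"
    if "(\<psi>, z) \<in> D" "k \<in> K" "k' \<in> K" "k \<otimes> x [^] i = k' \<otimes> x [^] j" for \<psi> z k k' and i j :: nat
    using wd'[OF that] wd'[OF that(1,3,2) that(4)[symmetric]] by (metis nle_le)
  \<comment> \<open>An element of \<open>L\<close> has many representations; by \<open>wd\<close>
    the choice among the resulting values is forced.\<close>
  define ext :: "('a \<Rightarrow> complex) \<times> complex \<Rightarrow> 'a \<Rightarrow> complex"
    where "ext = (\<lambda>(\<psi>, z). \<lambda>g\<in>L. SOME c. \<exists>k\<in>K. \<exists>i. g = k \<otimes> x [^] (i::nat) \<and> c = \<psi> k * z ^ i)"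
  have ext: "ext (\<psi>, z) (k \<otimes> x [^] i) = \<psi> k * z ^ i"
    if "(\<psi>, z) \<in> D" "k \<in> K" for \<psi> z k and i :: nat
  proof -
    have "(SOME c. \<exists>k'\<in>K. \<exists>j. k \<otimes> x [^] i = k' \<otimes> x [^] (j::nat) \<and> c = \<psi> k' * z ^ j) = \<psi> k * z ^ i"
      using that wd by (intro some_equality) (blast, metis)
    then show ?thesis
      using LI that(2) by (simp add: ext_def)
  qed
  have ext_char: "ext p \<in> characters ?L" if p: "p \<in> D" for p
  proof -
    obtain \<psi> z where pz: "p = (\<psi>, z)" by force
    have \<psi>: "\<psi> \<in> characters ?K" and z: "z ^ n = \<psi> (x [^] n)"
      using p pz by (auto simp: D_def)
    have z0: "z \<noteq> 0"
      using z n character_ne_0[OF \<psi>, of "x [^] n"] by (auto simp: zero_power)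
    have "ext p g \<noteq> 0" if "g \<in> L" for g
      using that z0 character_ne_0[OF \<psi>] p by (auto simp: L_iff pz ext)
    moreover have "ext p (g \<otimes> g') = ext p g * ext p g'" if "g \<in> L" "g' \<in> L" for g g'
      using that character_mult[OF \<psi>] p by (auto simp: L_iff pz ext mult power_add)
    ultimately show ?thesis
      by (auto simp: characters_iff ext_def split: prod.splits)
  qed
  \<comment> \<open>The values at exponent 0 recover \<open>\<psi>\<close>, and the value at
    \<open>x\<close> recovers \<open>z\<close>.\<close>
  have "inj_on ext D"
  proof (rule inj_onI, clarify)
    fix \<psi> z \<psi>' z' assume D: "(\<psi>, z) \<in> D" "(\<psi>', z') \<in> D" and eq: "ext (\<psi>, z) = ext (\<psi>', z')"
    have "\<psi> = \<psi>'"
    proof (rule character_eqI)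
      show "\<psi> \<in> characters ?K" "\<psi>' \<in> characters ?K"
        using D by (auto simp: D_def)
      fix k assume "k \<in> carrier ?K"
      then show "\<psi> k = \<psi>' k"
        using ext[OF D(1), of k 0] ext[OF D(2), of k 0] eq by simp
    qed
    moreover have "\<psi> \<one> * z = \<psi>' \<one> * z'"
      using ext[OF D(1) K.one_closed, of 1] ext[OF D(2) K.one_closed, of 1] eq by simp
    moreover have "\<psi> \<one> \<noteq> 0"
      using D(1) character_ne_0[of \<psi> ?K \<one>] by (simp add: D_def)
    ultimately show "\<psi> = \<psi>' \<and> z = z'" by simp
  qed
  then have "card D \<le> card (characters ?L)"
    using ext_char GL.finite_characters fin LG
    by (intro card_inj_on_le) (auto intro: finite_subset)
  \<comment> \<open>Since \<open>\<psi> (x [^] n)\<close> is nonzero and \<open>n\<close> is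
    positive, it has exactly \<open>n\<close> distinct roots of order \<open>n\<close>.\<close>
  moreover have "card D = n * card (characters ?K)"
  proof -
    have "finite (characters ?K)"
      using fin K.subset by (intro GK.finite_characters) (auto intro: finite_subset)
    then show ?thesis
      using n character_ne_0[of _ ?K "x [^] n"]
      by (auto simp: D_def card_SigmaI card_nth_roots finite_nth_roots)
  qed
  ultimately have "card L \<le> card (characters ?L)"
    using cardL le by (metis le_trans mult_le_mono2)
  then show ?thesis
    using subL KL xL that by blast
qed

text \<open>Among the subgroups satisfying the inequality, the trivial one being such, take a
  maximal one. Adjoining any \<open>x\<close> keeps the inequality, so maximality puts every
  \<open>x\<close> into it.\<close>

lemma card_carrier_le_card_characters:
  assumes fin: "finite (carrier G)"
  shows "card (carrier G) \<le> card (characters G)"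
proof -
  define S where "S = {K. subgroup K G \<and> card K \<le> card (characters (G\<lparr>carrier := K\<rparr>))}"
  have "{\<one>} \<in> S"
  proof -
    have "(\<lambda>x\<in>{\<one>}. 1) \<in> characters (G\<lparr>carrier := {\<one>}\<rparr>)"
      by (simp add: characters_iff)
    moreover have "finite (characters (G\<lparr>carrier := {\<one>}\<rparr>))"
      using triv_subgroup by (intro group.finite_characters subgroup_imp_group) auto
    ultimately show ?thesis
      by (auto simp: S_def triv_subgroup Suc_le_eq card_gt_0_iff)
  qed
  moreover have finS: "finite S"
    using fin by (intro finite_subset[of S "Pow (carrier G)"]) (auto simp: S_def dest: subgroup.subset)
  ultimately obtain K where K: "K \<in> S" and max: "\<And>L. L \<in> S \<Longrightarrow> K \<subseteq> L \<Longrightarrow> K = L"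
    by (metis finite_has_maximal2)
  have "x \<in> K" if x: "x \<in> carrier G" for x
  proof -
    obtain L where "L \<in> S" "K \<subseteq> L" "x \<in> L"
      using K card_characters_adjoin[OF fin _ x, of K] unfolding S_def by blast
    then show ?thesis
      using max by blast
  qed
  then have "K = carrier G"
    using K by (auto simp: S_def dest: subgroup.subset)
  then show ?thesis
    using K by (simp add: S_def)
qed

end

section \<open>Orthonormal bases\<close>

text \<open>The inner product of a vanishing combination with \<open>v\<close> isolates the
  coefficient \<open>a v\<close>.\<close>

lemma orthonormal_lin_indpt:
  assumes B: "B \<subseteq> carrier_vec n" "finite B"
    and orth: "\<And>x y. x \<in> B \<Longrightarrow> y \<in> B \<Longrightarrow> x \<bullet>c y = (if x = y then 1 else (0::complex))"
  shows "module.lin_indpt class_ring (module_vec TYPE(complex) n) B"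
proof -
  interpret vec_space "TYPE(complex)" n .
  show ?thesis
  proof (rule finite_lin_indpt2)
    fix a assume lc: "lincomb a B = 0\<^sub>v n"
    show "\<forall>v\<in>B. a v = 0"
    proof
      fix v assume v: "v \<in> B"
      have "0 = lincomb a B \<bullet>c v"
        using lc v B by (simp add: module_vec_simps subset_iff)
      also have "\<dots> = (\<Sum>i<n. \<Sum>x\<in>B. a x * x $ i * conjugate (v $ i))"
        using v B by (auto simp: scalar_prod_def lincomb_index lessThan_atLeast0 sum_distrib_right intro!: sum.cong)
      also have "\<dots> = (\<Sum>x\<in>B. a x * (x \<bullet>c v))"
        using v B by (subst sum.swap)
          (auto simp: scalar_prod_def lessThan_atLeast0 sum_distrib_left mult.assoc intro!: sum.cong)
      also have "\<dots> = a v"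
        using v B by (simp add: orth if_distrib[of "\<lambda>z. _ * z"] sum.delta cong: sum.cong if_cong)
      finally show "a v = 0"
        by simp
    qed
  qed (use B in auto)
qed

text \<open>Independence bounds the size by the dimension. This caps both the number of characters
  of a group and the size of each class of characters of \<open>H\<close>.\<close>

lemma orthonormal_card_le:
  assumes "B \<subseteq> carrier_vec n" "finite B"
    and "\<And>x y. x \<in> B \<Longrightarrow> y \<in> B \<Longrightarrow> x \<bullet>c y = (if x = y then 1 else (0::complex))"
  shows "card B \<le> n"
proof -
  interpret vec_space "TYPE(complex)" n .
  show ?thesis
    using li_le_dim(2)[OF fin_dim _ orthonormal_lin_indpt[OF assms]] assms(1) by (simp add: dim_is_n)
qed

lemma orthonormal_basisI:
  assumes B: "B \<subseteq> carrier_vec n" "finite B"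
    and orth: "\<And>x y. x \<in> B \<Longrightarrow> y \<in> B \<Longrightarrow> x \<bullet>c y = (if x = y then 1 else (0::complex))"
    and "card B = n"
  shows "orthonormal_basis n B"
proof -
  interpret vec_space "TYPE(complex)" n .
  have "basis B"
    using assms orthonormal_lin_indpt[OF B orth] by (intro dim_li_is_basis) (simp_all add: dim_is_n)
  then show ?thesis
    using orth by (simp add: orthonormal_basis_def)
qed

lemma orthonormal_basis_carrier: "orthonormal_basis n B \<Longrightarrow> B \<subseteq> carrier_vec n"
proof -
  interpret vec_space "TYPE(complex)" n .
  show "orthonormal_basis n B \<Longrightarrow> B \<subseteq> carrier_vec n"
    by (simp add: orthonormal_basis_def basis_def)
qed

lemma orthonormal_basis_unit_vecs: "orthonormal_basis n (set (unit_vecs n))"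
proof (rule orthonormal_basisI)
  show "card (set (unit_vecs n) :: complex vec set) = n"
    using vec_space.unit_vecs_distinct by (metis distinct_card vec_space.unit_vecs_length)
  fix x y :: "complex vec" assume "x \<in> set (unit_vecs n)" "y \<in> set (unit_vecs n)"
  then obtain i j where ij: "i < n" "j < n" "x = unit_vec n i" "y = unit_vec n j"
    by (auto simp: unit_vecs_def)
  moreover have "x = y \<longleftrightarrow> i = j"
    using ij by (metis index_unit_vec(1) zero_neq_one)
  ultimately show "x \<bullet>c y = (if x = y then 1 else 0)"
    by simp
qed (auto simp: unit_vecs_def)

lemma mutually_unbiased_sym:
  assumes "mutually_unbiased n B C" shows "mutually_unbiased n C B"
proof -
  have "cmod (x \<bullet>c y) = cmod (y \<bullet>c x)" if "x \<in> carrier_vec n" "y \<in> carrier_vec n" for x y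
  proof -
    have "conjugate (x \<bullet>c y) = y \<bullet>c x"
      using that conjugate_conjugate_sprod[of y n x] conjugate_vec_sprod_comm[of x n y] by simp
    then show ?thesis
      by (metis complex_mod_cnj conjugate_complex_def)
  qed
  then show ?thesis
    using assms orthonormal_basis_carrier unfolding mutually_unbiased_def by (metis subsetD)
qed

section \<open>Inner products of character vectors and the exact number of characters\<close>

lemma char_vec_carrier [simp]: "char_vec q h \<chi> \<in> carrier_vec q"
  by (simp add: char_vec_def)

text \<open>Reindexing along \<open>h\<close> makes inner products independent of the enumeration.
  \<open>A\<close> is left general: it is the whole group when characters are counted, and
  \<open>H_zero E\<close> for the bases.\<close>

lemma char_vec_cscalar_prod:
  assumes "bij_betw h {..<q} A"
  shows "char_vec q h \<chi> \<bullet>c char_vec q h \<psi> = (\<Sum>g\<in>A. \<chi> g * cnj (\<psi> g)) / of_nat q"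
proof -
  have "char_vec q h \<chi> \<bullet>c char_vec q h \<psi> = (\<Sum>i<q. \<chi> (h i) * cnj (\<psi> (h i)) / of_nat q)"
  proof -
    have "complex_of_real (sqrt q) * complex_of_real (sqrt q) = of_nat q"
      by (metis of_nat_0_le_iff of_real_mult of_real_of_nat_eq real_sqrt_mult_self abs_of_nonneg)
    then show ?thesis
      by (auto simp: char_vec_def scalar_prod_def lessThan_atLeast0 intro!: sum.cong)
  qed
  also have "\<dots> = (\<Sum>g\<in>A. \<chi> g * cnj (\<psi> g) / of_nat q)"
    by (rule sum.reindex_bij_betw[OF assms])
  finally show ?thesis
    by (simp add: sum_divide_distrib)
qed

text \<open>The normalised characters are orthonormal in dimension \<open>Coset.order G\<close>,
  which bounds their number from above; extension from subgroups bounds it from below.\<close>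

lemma (in comm_group) card_characters:
  assumes fin: "finite (carrier G)"
  shows "card (characters G) = Coset.order G"
proof (rule antisym)
  define q where "q = Coset.order G"
  have q: "q > 0" "card (carrier G) = q"
    using fin order_gt_0_iff_finite by (simp_all add: q_def Coset.order_def)
  obtain h where h: "bij_betw h {..<q} (carrier G)"
    using ex_bij_betw_nat_finite[OF fin] by (auto simp: q_def Coset.order_def lessThan_atLeast0)
  have orth: "char_vec q h \<chi> \<bullet>c char_vec q h \<psi> = (if \<chi> = \<psi> then 1 else 0)"
    if "\<chi> \<in> characters G" "\<psi> \<in> characters G" for \<chi> \<psi>
  proof (cases "\<chi> = \<psi>")
    case True
    then show ?thesis
      using that q cmod_character[OF fin]
      by (simp add: char_vec_cscalar_prod[OF h] complex_norm_square[symmetric])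
  next
    case False
    then show ?thesis
      using that sum_character_mult_cnj[OF fin] by (simp add: char_vec_cscalar_prod[OF h])
  qed
  have inj: "inj_on (char_vec q h) (characters G)"
    using orth by (intro inj_onI) (metis zero_neq_one)
  have "card (char_vec q h ` characters G) \<le> q"
    using finite_characters[OF fin] by (intro orthonormal_card_le) (auto simp: orth)
  then show "card (characters G) \<le> Coset.order G"
    using card_image[OF inj] by (simp add: q_def)
  show "Coset.order G \<le> card (characters G)"
    using card_carrier_le_card_characters[OF fin] by (simp add: Coset.order_def)
qed

section \<open>Character sums over \<open>H\<^sub>0\<close>\<close>

context finite_commutative_semifield
begin

lemma mult_zero: "x \<in> carrier E \<Longrightarrow> x \<otimes> \<zero> = \<zero>"
  using distrib_left[of x \<zero> \<zero>] by (simp add: mult_closed)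

text \<open>If \<open>u\<close> and \<open>v\<close> have the same image, distributivity gives
  \<open>(u \<oplus> \<ominus> v) \<otimes> w = \<zero>\<close>, so the lack of zero divisors yields
  injectivity, and finiteness then yields surjectivity.\<close>

lemma bij_betw_mult:
  assumes w: "w \<in> carrier E" "w \<noteq> \<zero>"
  shows "bij_betw (\<lambda>v. v \<otimes> w) (carrier E) (carrier E)"
proof -
  have "inj_on (\<lambda>v. v \<otimes> w) (carrier E)"
  proof (rule inj_onI)
    fix u v assume *: "u \<in> carrier E" "v \<in> carrier E" "u \<otimes> w = v \<otimes> w"
    have "(u \<oplus> \<ominus> v) \<otimes> w \<oplus> v \<otimes> w = v \<otimes> w"
      using * w distrib_right[of w "u \<oplus> \<ominus> v" v] by (simp add: a_assoc l_neg)
    then have "(u \<oplus> \<ominus> v) \<otimes> w = \<zero>"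
      using * w by (simp add: mult_closed)
    then have "u \<oplus> \<ominus> v = \<zero>"
      using no_zero_divisors[of "u \<oplus> \<ominus> v" w] * w by auto
    then show "u = v"
      using * by (metis add.inv_equality add.inv_closed minus_minus)
  qed
  moreover have "(\<lambda>v. v \<otimes> w) ` carrier E \<subseteq> carrier E"
    using w by (auto simp: mult_closed)
  ultimately show ?thesis
    using finite_carrier by (simp add: bij_betw_def endo_inj_surj)
qed

lemma carrier_H_group: "carrier (H_group E) = {H_map E u b | u b. u \<in> carrier E \<and> b \<in> carrier E}"
  by (simp add: H_group_def)

lemma H_map_in_carrier: "\<lbrakk>u \<in> carrier E; b \<in> carrier E\<rbrakk> \<Longrightarrow> H_map E u b \<in> carrier (H_group E)"
  by (auto simp: carrier_H_group)

lemma finite_H_group: "finite (carrier (H_group E))"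
proof -
  have "carrier (H_group E) = (\<lambda>(u, b). H_map E u b) ` (carrier E \<times> carrier E)"
    by (auto simp: carrier_H_group)
  then show ?thesis
    using finite_carrier by simp
qed

lemma sum_H_zero: "(\<Sum>g\<in>H_zero E. f g) = (\<Sum>u\<in>carrier E. f (H_map E u \<zero>))"
proof -
  have "H_zero E = (\<lambda>u. H_map E u \<zero>) ` carrier E"
    by (auto simp: H_zero_def)
  moreover have "inj_on (\<lambda>u. H_map E u \<zero>) (carrier E)"
    using inj_onD[OF inj_H_map] by (intro inj_onI) force
  ultimately show ?thesis
    by (simp add: sum.reindex)
qed

text \<open>Extensional on \<open>carrier E\<close>, so that equality of two such functions means
  agreement on all \<open>H_map E \<zero> b\<close>, and the result can be a member of
  \<open>characters (add_monoid E)\<close>.\<close>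

definition central_character :: "(('a \<times> 'a \<Rightarrow> 'a \<times> 'a) \<Rightarrow> complex) \<Rightarrow> 'a \<Rightarrow> complex" where
  "central_character \<chi> = (\<lambda>b\<in>carrier E. \<chi> (H_map E \<zero> b))"

lemma central_character_in_characters:
  assumes "\<chi> \<in> characters (H_group E)" shows "central_character \<chi> \<in> characters (add_monoid E)"
proof -
  have "\<chi> (H_map E \<zero> (b \<oplus> d)) = \<chi> (H_map E \<zero> b) * \<chi> (H_map E \<zero> d)"
    if "b \<in> carrier E" "d \<in> carrier E" for b d
    using character_mult[OF assms, of "H_map E \<zero> b" "H_map E \<zero> d"] that
    by (simp add: H_map_in_carrier H_map_mult mult_zero)
  then show ?thesis
    using character_ne_0[OF assms]
    by (auto simp: characters_iff central_character_def H_map_in_carrier)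
qed

lemma character_H_map:
  assumes "\<chi> \<in> characters (H_group E)" "u \<in> carrier E" "b \<in> carrier E"
  shows "\<chi> (H_map E u b) = \<chi> (H_map E u \<zero>) * \<chi> (H_map E \<zero> b)"
  using character_mult[OF assms(1), of "H_map E u \<zero>" "H_map E \<zero> b"] assms(2,3)
  by (simp add: H_map_in_carrier H_map_mult mult_zero)

text \<open>The factor at \<open>u \<otimes> v\<close> measures how far
  \<open>u \<mapsto> \<chi> (H_map E u \<zero>)\<close> is from being additive.\<close>

lemma character_H_map_add:
  assumes "\<chi> \<in> characters (H_group E)" "u \<in> carrier E" "v \<in> carrier E"
  shows "\<chi> (H_map E (u \<oplus> v) \<zero>) * \<chi> (H_map E \<zero> (u \<otimes> v)) =
    \<chi> (H_map E u \<zero>) * \<chi> (H_map E v \<zero>)"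
proof -
  have "\<chi> (H_map E u \<zero>) * \<chi> (H_map E v \<zero>) = \<chi> (H_map E (u \<oplus> v) (u \<otimes> v))"
    using character_mult[OF assms(1), of "H_map E u \<zero>" "H_map E v \<zero>"] assms(2,3)
    by (simp add: H_map_in_carrier H_map_mult mult_closed)
  then show ?thesis
    using character_H_map[OF assms(1), of "u \<oplus> v" "u \<otimes> v"] assms(2,3) by (simp add: mult_closed)
qed

text \<open>Triviality on the copy of \<open>E\<close> removes the correction factor, so
  \<open>\<eta>\<close> is a character of the additive group. It is nontrivial because
  \<open>\<theta>\<close> at \<open>H_map E u b\<close> equals \<open>\<eta> u\<close>.\<close>

lemma sum_H_zero_eq_0:
  assumes \<theta>: "\<theta> \<in> characters (H_group E)" and g: "g \<in> carrier (H_group E)" "\<theta> g \<noteq> 1"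
    and triv: "\<And>b. b \<in> carrier E \<Longrightarrow> \<theta> (H_map E \<zero> b) = 1"
  shows "(\<Sum>h\<in>H_zero E. \<theta> h) = 0"
proof -
  define \<eta> where "\<eta> = (\<lambda>u\<in>carrier E. \<theta> (H_map E u \<zero>))"
  have "\<eta> \<in> characters (add_monoid E)"
    using character_H_map_add[OF \<theta>] character_ne_0[OF \<theta>]
    by (auto simp: \<eta>_def characters_iff triv mult_closed H_map_in_carrier)
  moreover obtain u b where u: "u \<in> carrier E" and b: "b \<in> carrier E" and "g = H_map E u b"
    using g(1) by (auto simp: carrier_H_group)
  then have "\<eta> u \<noteq> 1"
    using g(2) character_H_map[OF \<theta> u b] by (simp add: \<eta>_def triv)
  ultimately have "(\<Sum>u\<in>carrier E. \<eta> u) = 0"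
    using add.sum_character_eq_0 u by fastforce
  then show ?thesis
    by (simp add: sum_H_zero \<eta>_def)
qed

text \<open>The argument is the evaluation of the modulus of a quadratic Gauss sum, with
  \<open>u \<mapsto> \<theta> (H_map E u \<zero>)\<close> as the quadratic phase.\<close>

lemma cmod_sum_H_zero:
  assumes \<theta>: "\<theta> \<in> characters (H_group E)" and b: "b \<in> carrier E" "\<theta> (H_map E \<zero> b) \<noteq> 1"
  shows "cmod (\<Sum>h\<in>H_zero E. \<theta> h) = sqrt (Coset.order E)"
proof -
  interpret H: comm_group "H_group E" by (rule comm_group_H_group)
  let ?f = "\<lambda>u. \<theta> (H_map E u \<zero>)" and ?z = "\<lambda>b. \<theta> (H_map E \<zero> b)"
  have unit: "\<theta> g * cnj (\<theta> g) = 1" if "g \<in> carrier (H_group E)" for g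
    using H.cmod_character[OF finite_H_group \<theta> that] by (simp add: complex_norm_square[symmetric])
  \<comment> \<open>Differencing the phase leaves a term in \<open>w\<close> alone and an additive
    character in \<open>v \<otimes> w\<close>.\<close>
  have shift: "?f (v \<oplus> w) * cnj (?f v) = ?f w * cnj (?z (v \<otimes> w))"
    if "v \<in> carrier E" "w \<in> carrier E" for v w
  proof -
    have "?f (v \<oplus> w) * cnj (?f v) = (?f (v \<oplus> w) * ?z (v \<otimes> w)) * cnj (?f v) * cnj (?z (v \<otimes> w))"
      using unit[of "H_map E \<zero> (v \<otimes> w)"] that by (simp add: H_map_in_carrier mult_closed)
    also have "\<dots> = ?f w * (?f v * cnj (?f v)) * cnj (?z (v \<otimes> w))"
      using character_H_map_add[OF \<theta> that] by simp
    finally show ?thesis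
      using unit[of "H_map E v \<zero>"] that by (simp add: H_map_in_carrier)
  qed
  have "central_character \<theta> b \<noteq> 1"
    using b by (simp add: central_character_def)
  then have "(\<Sum>b\<in>carrier E. central_character \<theta> b) = 0"
    using add.sum_character_eq_0[OF central_character_in_characters[OF \<theta>]] b(1) by simp
  then have sum_z: "(\<Sum>b\<in>carrier E. ?z b) = 0"
    by (simp add: central_character_def)
  \<comment> \<open>For nonzero \<open>w\<close>, the map \<open>v \<mapsto> v \<otimes> w\<close>
    permutes \<open>E\<close>, so this is the vanishing full sum \<open>sum_z\<close>.\<close>
  have inner: "(\<Sum>v\<in>carrier E. ?z (v \<otimes> w)) = (if w = \<zero> then of_nat (Coset.order E) else 0)"
    if w: "w \<in> carrier E" for w
  proof (cases "w = \<zero>")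
    case True
    have "?z \<zero> = 1"
      using character_H_map[OF \<theta>, of \<zero> \<zero>] character_ne_0[OF \<theta>, of "H_map E \<zero> \<zero>"]
      by (simp add: H_map_in_carrier)
    then show ?thesis
      using True by (simp add: mult_zero Coset.order_def)
  next
    case False
    then show ?thesis
      using sum.reindex_bij_betw[OF bij_betw_mult[OF w], of ?z] sum_z by simp
  qed
  define S where "S = (\<Sum>h\<in>H_zero E. \<theta> h)"
  have "S * cnj S = (\<Sum>v\<in>carrier E. \<Sum>u\<in>carrier E. ?f u * cnj (?f v))"
    unfolding S_def sum_H_zero cnj_sum sum_product by (rule sum.swap)
  \<comment> \<open>Substituting \<open>u = v \<oplus> w\<close> brings the summand into the form of
    \<open>shift\<close>.\<close>
  also have "\<dots> = (\<Sum>v\<in>carrier E. \<Sum>w\<in>carrier E. ?f (v \<oplus> w) * cnj (?f v))"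
  proof (rule sum.cong)
    fix v assume v: "v \<in> carrier E"
    show "(\<Sum>u\<in>carrier E. ?f u * cnj (?f v)) = (\<Sum>w\<in>carrier E. ?f (v \<oplus> w) * cnj (?f v))"
      using v by (intro sum.reindex_bij_witness[of _ "\<lambda>w. v \<oplus> w" "\<lambda>u. \<ominus> v \<oplus> u"])
        (auto simp: r_neg1 r_neg2)
  qed simp
  also have "\<dots> = (\<Sum>v\<in>carrier E. \<Sum>w\<in>carrier E. ?f w * cnj (?z (v \<otimes> w)))"
    by (intro sum.cong) (simp_all add: shift)
  also have "\<dots> = (\<Sum>w\<in>carrier E. ?f w * cnj (\<Sum>v\<in>carrier E. ?z (v \<otimes> w)))"
    by (subst sum.swap) (simp add: sum_distrib_left)
  also have "\<dots> = (\<Sum>w\<in>carrier E. if w = \<zero> then ?f \<zero> * of_nat (Coset.order E) else 0)"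
    by (intro sum.cong) (simp_all add: inner)
  also have "\<dots> = ?f \<zero> * of_nat (Coset.order E)"
    using finite_carrier by simp
  \<comment> \<open>\<open>?f \<zero>\<close> is nonzero and equals its own square.\<close>
  also have "?f \<zero> = 1"
    using inner[of \<zero>] character_H_map[OF \<theta>, of \<zero> \<zero>] character_ne_0[OF \<theta>, of "H_map E \<zero> \<zero>"]
    by (simp add: H_map_in_carrier)
  finally have "complex_of_real ((cmod S)\<^sup>2) = complex_of_real (Coset.order E)"
    by (simp add: complex_norm_square[symmetric])
  then have "(cmod S)\<^sup>2 = Coset.order E"
    by (simp only: of_real_eq_iff)
  then show ?thesis
    by (metis S_def norm_ge_zero real_sqrt_unique)
qed

end

section \<open>Assembly of the mutually unbiased bases\<close>

theorem corollary5p2: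
  fixes E :: "('a, 'm) ring_scheme" and q :: nat
    and h :: "nat \<Rightarrow> 'a \<times> 'a \<Rightarrow> 'a \<times> 'a"
  assumes "finite_commutative_semifield E"
    and "Coset.order E = q"
    and "bij_betw h {..<q} (H_zero E)"
  shows "card (characters (H_group E)) = q\<^sup>2 \<and>
    inj_on (char_vec q h) (characters (H_group E)) \<and>
    (\<exists>P. partition_on (char_vec q h ` characters (H_group E)) P \<and>
      card P = q \<and>
      (\<forall>B\<in>P. orthonormal_basis q B) \<and>
      card (insert (set (unit_vecs q)) P) = q + 1 \<and>
      pairwise (mutually_unbiased q) (insert (set (unit_vecs q)) P))"
proof -
  interpret finite_commutative_semifield E by fact
  interpret H: comm_group "H_group E" by (rule comm_group_H_group)
  note h = assms(3)
  let ?X = "characters (H_group E)" and ?Y = "characters (add_monoid E)" and ?V = "char_vec q h"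
  have cardX: "card ?X = q\<^sup>2"
    using H.card_characters[OF finite_H_group] order_H_group assms(2) by simp
  have finX: "finite ?X"
    using H.finite_characters[OF finite_H_group] .
  have cardY: "card ?Y = q"
    using add.card_characters finite_carrier assms(2) by (simp add: Coset.order_def)
  have finY: "finite ?Y"
    using add.finite_characters finite_carrier by simp
  have q: "q > 1"
    using card_mono[of "carrier E" "{\<zero>\<^bsub>E\<^esub>, \<one>\<^bsub>E\<^esub>}"] finite_carrier one_carrier one_neq_zero assms(2)
    by (auto simp: Coset.order_def)
  \<comment> \<open>That \<open>1 / sqrt q\<close> differs from 1 separates vectors of different
    classes, and keeps the standard basis apart from the classes.\<close>
  have root: "1 / sqrt q \<noteq> 1" "1 / sqrt q \<noteq> 0"
    using q by auto
  have cmod1: "cmod (\<chi> g) = 1" if "\<chi> \<in> ?X" "g \<in> carrier (H_group E)" for \<chi> g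
    using H.cmod_character[OF finite_H_group that] .
  have H0: "g \<in> carrier (H_group E)" if "g \<in> H_zero E" for g
    using that by (auto simp: H_zero_def carrier_H_group)
  \<comment> \<open>The restriction to the carrier makes the product a character in the extensional
    sense, so both sum lemmas apply to it.\<close>
  have ip_theta: "?V \<chi> \<bullet>c ?V \<psi> =
      (\<Sum>g\<in>H_zero E. (\<lambda>g\<in>carrier (H_group E). \<chi> g * cnj (\<psi> g)) g) / of_nat q" for \<chi> \<psi>
    using H0 by (simp add: char_vec_cscalar_prod[OF h] cong: sum.cong)
  have unit: "\<chi> g * cnj (\<chi> g) = 1" if "\<chi> \<in> ?X" "g \<in> carrier (H_group E)" for \<chi> g
    using cmod1[OF that] by (simp add: complex_norm_square[symmetric])
  have ne1: "\<chi> g * cnj (\<psi> g) \<noteq> 1"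
    if "\<psi> \<in> ?X" "g \<in> carrier (H_group E)" "\<chi> g \<noteq> \<psi> g" for \<chi> \<psi> :: "_ \<Rightarrow> complex" and g
    using unit[OF that(1,2)] that(3) by (metis mult_right_cancel mult_zero_right zero_neq_one)
  have ip_self: "?V \<chi> \<bullet>c ?V \<chi> = 1" if "\<chi> \<in> ?X" for \<chi>
    using that unit H0 q card_H_zero assms(2) by (simp add: char_vec_cscalar_prod[OF h])
  have ip_same: "?V \<chi> \<bullet>c ?V \<psi> = 0"
    if *: "\<chi> \<in> ?X" "\<psi> \<in> ?X" "\<chi> \<noteq> \<psi>" "central_character \<chi> = central_character \<psi>" for \<chi> \<psi>
  proof -
    obtain g where g: "g \<in> carrier (H_group E)" "\<chi> g \<noteq> \<psi> g"
      using character_eqI[OF *(1,2)] *(3) by blast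
    have eq: "\<chi> (H_map E \<zero>\<^bsub>E\<^esub> b) = \<psi> (H_map E \<zero>\<^bsub>E\<^esub> b)" if "b \<in> carrier E" for b
      using *(4) that
      by (metis central_character_def restrict_apply')
    show ?thesis
      unfolding ip_theta
      using sum_H_zero_eq_0[OF H.character_mult_cnj[OF *(1,2)] g(1)] ne1[OF *(2) g(1), where \<chi> = \<chi>] g(2) g(1)
        unit[OF *(2)] by (simp add: H_map_in_carrier eq)
  qed
  have ip_diff: "cmod (?V \<chi> \<bullet>c ?V \<psi>) = 1 / sqrt q"
    if *: "\<chi> \<in> ?X" "\<psi> \<in> ?X" "central_character \<chi> \<noteq> central_character \<psi>" for \<chi> \<psi>
  proof -
    obtain b where b: "b \<in> carrier E" "\<chi> (H_map E \<zero>\<^bsub>E\<^esub> b) \<noteq> \<psi> (H_map E \<zero>\<^bsub>E\<^esub> b)"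
      using *(3) by (auto simp: central_character_def fun_eq_iff restrict_def split: if_splits)
    have "cmod (\<Sum>g\<in>H_zero E. (\<lambda>g\<in>carrier (H_group E). \<chi> g * cnj (\<psi> g)) g) = sqrt q"
      using cmod_sum_H_zero[OF H.character_mult_cnj[OF *(1,2)] b(1)]
        ne1[OF *(2), where \<chi> = \<chi>] b(2) b(1) assms(2) by (simp add: H_map_in_carrier)
    then show ?thesis
      unfolding ip_theta using q by (simp add: norm_divide divide_eq_eq real_div_sqrt)
  qed
  have inj: "inj_on ?V ?X"
  proof (rule inj_onI, rule ccontr)
    fix \<chi> \<psi> assume *: "\<chi> \<in> ?X" "\<psi> \<in> ?X" "?V \<chi> = ?V \<psi>" "\<chi> \<noteq> \<psi>"
    then have "?V \<chi> \<bullet>c ?V \<psi> = 1"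
      using ip_self by simp
    then show False
      using ip_same[of \<chi> \<psi>] ip_diff[of \<chi> \<psi>] * root by (metis norm_one zero_neq_one)
  qed
  \<comment> \<open>The fibres of restriction to the copy of \<open>E\<close>; their images are the
    desired bases.\<close>
  define F where "F \<eta> = {\<chi> \<in> ?X. central_character \<chi> = \<eta>}" for \<eta>
  have finF: "finite (F \<eta>)" and FX: "F \<eta> \<subseteq> ?X" for \<eta>
    using finX by (auto simp: F_def)
  have orthF: "x \<bullet>c y = (if x = y then 1 else 0)" if "x \<in> ?V ` F \<eta>" "y \<in> ?V ` F \<eta>" for x y \<eta>
  proof -
    obtain \<chi> \<psi> where *: "\<chi> \<in> F \<eta>" "\<psi> \<in> F \<eta>" "x = ?V \<chi>" "y = ?V \<psi>"
      using \<open>x \<in> ?V ` F \<eta>\<close> \<open>y \<in> ?V ` F \<eta>\<close> by blast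
    then show ?thesis
      using ip_self[of \<chi>] ip_same[of \<chi> \<psi>] by (cases "\<chi> = \<psi>") (auto simp: F_def)
  qed
  have VF: "?V ` F \<eta> \<subseteq> carrier_vec q" "finite (?V ` F \<eta>)" for \<eta>
    using finF by auto
  have card_VF: "card (?V ` F \<eta>) = card (F \<eta>)" for \<eta>
    using inj FX by (meson card_image inj_on_subset)
  have F_le: "card (F \<eta>) \<le> q" for \<eta>
    using orthonormal_card_le[OF VF orthF[where \<eta> = \<eta>], of \<eta>] by (simp add: card_VF)
  have "card ?X = (\<Sum>\<eta>\<in>?Y. card (F \<eta>))"
  proof -
    have "?X = (\<Union>\<eta>\<in>?Y. F \<eta>)"
      using central_character_in_characters by (auto simp: F_def)
    moreover have "card (\<Union>\<eta>\<in>?Y. F \<eta>) = (\<Sum>\<eta>\<in>?Y. card (F \<eta>))"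
      using finY finF by (intro card_UN_disjoint) (auto simp: F_def)
    ultimately show ?thesis
      by metis
  qed
  then have sumF: "(\<Sum>\<eta>\<in>?Y. card (F \<eta>)) = (\<Sum>\<eta>\<in>?Y. q)"
    using cardX cardY by (simp add: power2_eq_square)
  \<comment> \<open>There are \<open>q\<close> fibres of size at most \<open>q\<close> with total
    size \<open>q\<^sup>2\<close>; a single smaller fibre would make the total too small.\<close>
  have card_F: "card (F \<eta>) = q" if "\<eta> \<in> ?Y" for \<eta>
  proof (rule ccontr)
    assume "card (F \<eta>) \<noteq> q"
    then have "(\<Sum>\<eta>\<in>?Y. card (F \<eta>)) < (\<Sum>\<eta>\<in>?Y. q)"
      using F_le that finY by (intro sum_strict_mono_ex1) (auto simp: order_less_le)
    then show False
      using sumF by simp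
  qed
  define P where "P = (\<lambda>\<eta>. ?V ` F \<eta>) ` ?Y"
  have basis: "orthonormal_basis q B" if "B \<in> P" for B
  proof -
    obtain \<eta> where "\<eta> \<in> ?Y" "B = ?V ` F \<eta>"
      using \<open>B \<in> P\<close> by (auto simp: P_def)
    then show ?thesis
      using orthonormal_basisI[OF VF orthF[where \<eta> = \<eta>], of \<eta>] by (simp add: card_VF card_F)
  qed
  have F_ne: "F \<eta> \<noteq> {}" if "\<eta> \<in> ?Y" for \<eta>
    using card_F[OF that] q by auto
  have disj: "?V ` F \<eta> \<inter> ?V ` F \<eta>' = {}" if "\<eta> \<noteq> \<eta>'" for \<eta> \<eta>'
    using that inj_onD[OF inj] by (auto simp: F_def)
  \<comment> \<open>Disjoint images coincide only when empty, so nonempty fibres give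
    \<open>q\<close> different bases.\<close>
  have "inj_on (\<lambda>\<eta>. ?V ` F \<eta>) ?Y"
    using disj F_ne by (intro inj_onI) (metis Int_absorb image_is_empty)
  then have cardP: "card P = q"
    by (simp add: P_def card_image cardY)
  have part: "partition_on (?V ` ?X) P"
  proof (rule partition_onI)
    show "\<Union>P = ?V ` ?X"
      using central_character_in_characters by (auto simp: P_def F_def)
    show "{} \<notin> P"
      using F_ne by (auto simp: P_def)
    fix B C assume "B \<in> P" "C \<in> P" "B \<noteq> C"
    then obtain \<eta> \<eta>' where "B = ?V ` F \<eta>" "C = ?V ` F \<eta>'" "\<eta> \<noteq> \<eta>'"
      by (auto simp: P_def)
    then show "disjnt B C"
      using disj[of \<eta> \<eta>'] by (simp add: disjnt_def)
  qed
  \<comment> \<open>A unit vector picks out one coordinate, and every coordinate is a number of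
    modulus 1 divided by \<open>sqrt q\<close>.\<close>
  have ip_unit: "cmod (x \<bullet>c ?V \<chi>) = 1 / sqrt q" if "x \<in> set (unit_vecs q)" "\<chi> \<in> ?X" for x \<chi>
  proof -
    obtain i where i: "i < q" "x = unit_vec q i"
      using \<open>x \<in> set (unit_vecs q)\<close> by (auto simp: unit_vecs_def)
    then have "h i \<in> carrier (H_group E)"
      using h H0 by (auto simp: bij_betw_def)
    then show ?thesis
      using i cmod1[OF that(2)] by (simp add: char_vec_def norm_divide)
  qed
  have mub_unit: "mutually_unbiased q (set (unit_vecs q)) B" if "B \<in> P" for B
  proof -
    obtain \<eta> where B: "B = ?V ` F \<eta>"
      using \<open>B \<in> P\<close> by (auto simp: P_def)
    have "\<forall>x\<in>set (unit_vecs q). \<forall>y\<in>B. cmod (x \<bullet>c y) = 1 / sqrt q"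
      using ip_unit FX unfolding B by blast
    then show ?thesis
      using basis[OF that] orthonormal_basis_unit_vecs unfolding mutually_unbiased_def by blast
  qed
  \<comment> \<open>Otherwise some character vector would be a unit vector, and its inner product
    with itself would have modulus both 1 and \<open>1 / sqrt q\<close>.\<close>
  have "set (unit_vecs q) \<notin> P"
  proof
    assume "set (unit_vecs q) \<in> P"
    then obtain \<eta> where \<eta>: "\<eta> \<in> ?Y" "set (unit_vecs q) = ?V ` F \<eta>"
      by (auto simp: P_def)
    then obtain \<chi> where "\<chi> \<in> F \<eta>"
      using F_ne by blast
    then have "\<chi> \<in> ?X" "?V \<chi> \<in> set (unit_vecs q)"
      using FX \<eta>(2) by blast+
    then show False
      using ip_unit[of "?V \<chi>" \<chi>] ip_self[of \<chi>] root by simp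
  qed
  then have "card (insert (set (unit_vecs q)) P) = q + 1"
    using cardP finY by (simp add: P_def)
  moreover have "mutually_unbiased q B C" if "B \<in> P" "C \<in> P" "B \<noteq> C" for B C
  proof -
    obtain \<eta> \<eta>' where BC: "B = ?V ` F \<eta>" "C = ?V ` F \<eta>'" "\<eta> \<noteq> \<eta>'"
      using \<open>B \<in> P\<close> \<open>C \<in> P\<close> \<open>B \<noteq> C\<close> by (auto simp: P_def)
    have "\<forall>x\<in>B. \<forall>y\<in>C. cmod (x \<bullet>c y) = 1 / sqrt q"
      using ip_diff BC(3) unfolding BC(1,2) F_def by blast
    then show ?thesis
      using basis that unfolding mutually_unbiased_def by blast
  qed
  then have "pairwise (mutually_unbiased q) (insert (set (unit_vecs q)) P)"
    using mub_unit mutually_unbiased_sym unfolding pairwise_insert by (blast intro: pairwiseI)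
  ultimately show ?thesis
    using cardX inj part cardP basis by blast
qed

end
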